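(* Let $\Sigma$ be an immersed, degenerate almost complex surface in the nearly Kähler manifold $(\mathrm{SL}_2\mathbb{R}\times\mathrm{SL}_2\mathbb{R}, J, g)$ for which the almost product structure $P$ preserves the tangent bundle, i.e. $P(T\Sigma)=T\Sigma$. Then $\Sigma$ is locally congruent to an open part of the immersion $$F:\mathbb{R}^2\rightarrow \mathrm{SL}_2\mathbb{R}\times\mathrm{SL}_2\mathbb{R}: (s,t)\mapsto\left(\begin{pmatrix}1&2s\\ 0&1\end{pmatrix},\begin{pmatrix}1&2t\\ 0&1\end{pmatrix}\right).$$
   Context: $\mathrm{SL}_2\mathbb{R}$ is the group of real $2\times2$ matrices of determinant $1$, with Lie algebra $\mathfrak{sl}_2\mathbb{R}$ (traceless real $2\times 2$ matrices), so $T_A\mathrm{SL}_2\mathbb{R}=\{A\alpha : \alpha\in\mathfrak{sl}_2\mathbb{R}\}$. Identify $2\times2$ matrices $\begin{pmatrix}x_1&x_2\\ x_3&x_4\end{pmatrix}$ with $\mathbb{R}^4$ and put $\langle x,y\rangle=-\frac12(x_1y_4-x_2y_3-x_3y_2+x_4y_1)$; then $\langle A,A\rangle=-\det A$, and $\langle\,,\rangle$ restricts to a bi-invariant Lorentzian metric on $\mathrm{SL}_2\mathbb{R}$. The product metric on $\mathrm{SL}_2\mathbb{R}\times\mathrm{SL}_2\mathbb{R}$ is also denoted $\langle\,,\rangle$. For $(A\alpha,B\beta)\in T_{(A,B)}(\mathrm{SL}_2\mathbb{R}\times\mathrm{SL}_2\mathbb{R})$, $\alpha,\beta\in\mathfrak{sl}_2\mathbb{R}$,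 define the almost complex structure $J(A\alpha,B\beta)=\frac{1}{\sqrt3}(A(\alpha-2\beta),B(2\alpha-\beta))$, the almost product structure $P(A\alpha,B\beta)=(A\beta,B\alpha)$, and the nearly Kähler metric $g(Z,Z')=\frac14(\langle Z,Z'\rangle+\langle JZ,JZ'\rangle)$. An immersed surface $\Sigma$ is almost complex if $J(T\Sigma)=T\Sigma$, and degenerate if the restriction of $g$ to $T\Sigma$ vanishes identically. "Locally congruent to an open part of $F$" means that every point of $\Sigma$ has a neighbourhood which is mapped by some isometry of $(\mathrm{SL}_2\mathbb{R}\times\mathrm{SL}_2\mathbb{R},g)$ onto the image under $F$ of an open subset of the domain of $F$. *)

theory Defs
  imports "HOL-Analysis.Analysis"
begin

section \<open>Smooth maps and smooth surfaces\<close>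

text \<open>
  For open \<open>S\<close>, continuity of all iterated directional derivatives up to order \<open>k\<close>; in finite
  dimension this is the usual class \<open>C\<close>-\<open>k\<close>.
\<close>

primrec Ck_on :: "nat \<Rightarrow> 'a::euclidean_space set \<Rightarrow> ('a \<Rightarrow> 'b::euclidean_space) \<Rightarrow> bool" where
  "Ck_on 0 S h \<longleftrightarrow> continuous_on S h"
| "Ck_on (Suc k) S h \<longleftrightarrow>
     (\<forall>x\<in>S. h differentiable (at x)) \<and>
     (\<forall>v. Ck_on k S (\<lambda>x. frechet_derivative h (at x) v))"

definition smooth_on :: "'a::euclidean_space set \<Rightarrow> ('a \<Rightarrow> 'b::euclidean_space) \<Rightarrow> bool" where
  "smooth_on S h \<longleftrightarrow> open S \<and> (\<forall>k. Ck_on k S h)"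

text \<open>
  An abstract smooth surface: a topological space \<open>M\<close> whose atlas \<open>\<A>\<close> consists of pairs
  \<open>(U, x)\<close> of an open set \<open>U\<close> and a coordinate map \<open>x\<close> on \<open>U\<close>. The inverse of the chart
  is \<open>inv_into U x\<close>, defined on \<open>x ` U\<close>. The atlas need not be maximal.
\<close>

definition smooth_surface ::
  "'a topology \<Rightarrow> ('a set \<times> ('a \<Rightarrow> real \<times> real)) set \<Rightarrow> bool" where
  "smooth_surface M \<A> \<longleftrightarrow>
     Hausdorff_space M \<and> second_countable M \<and>
     (\<Union>(U, x)\<in>\<A>. U) = topspace M \<and>
     (\<forall>(U, x)\<in>\<A>. openin M U \<and> open (x ` U) \<and>
        homeomorphic_map (subtopology M U) (top_of_set (x ` U)) x) \<and>
     (\<forall>(U, x)\<in>\<A>. \<forall>(V, y)\<in>\<A>. smooth_on (x ` (U \<inter> V)) (y \<circ> inv_into U x))"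

section \<open>The nearly Kaehler manifold\<close>

type_synonym mat2 = "real^2^2"

definition SL2 :: "mat2 set" where
  "SL2 = {A. det A = 1}"

definition sl2 :: "mat2 set" where
  "sl2 = {\<alpha>. trace \<alpha> = 0}"

definition SL2xSL2 :: "(mat2 \<times> mat2) set" where
  "SL2xSL2 = SL2 \<times> SL2"

definition tangent_SL2xSL2 :: "mat2 \<times> mat2 \<Rightarrow> (mat2 \<times> mat2) set" where
  "tangent_SL2xSL2 = (\<lambda>(A, B). {(A ** \<alpha>, B ** \<beta>) | \<alpha> \<beta>. \<alpha> \<in> sl2 \<and> \<beta> \<in> sl2})"

definition mat_form :: "mat2 \<Rightarrow> mat2 \<Rightarrow> real" where
  "mat_form X Y =
     - (1 / 2) * (X$1$1 * Y$2$2 - X$1$2 * Y$2$1 - X$2$1 * Y$1$2 + X$2$2 * Y$1$1)"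

definition prod_form :: "mat2 \<times> mat2 \<Rightarrow> mat2 \<times> mat2 \<Rightarrow> real" where
  "prod_form Z Z' = mat_form (fst Z) (fst Z') + mat_form (snd Z) (snd Z')"

text \<open>
  The structures \<open>J\<close> and \<open>P\<close> take the base point \<open>(A, B)\<close> as first argument; a tangent vector
  \<open>(X, Y)\<close> at \<open>(A, B)\<close> is written as \<open>(A ** \<alpha>, B ** \<beta>)\<close> by inverting \<open>A\<close> and \<open>B\<close>. See the
  lemmas \<open>nk_J_apply\<close> and \<open>nk_P_apply\<close> below.
\<close>

definition nk_J :: "mat2 \<times> mat2 \<Rightarrow> mat2 \<times> mat2 \<Rightarrow> mat2 \<times> mat2" where
  "nk_J = (\<lambda>(A, B) (X, Y).
     let \<alpha> = matrix_inv A ** X; \<beta> = matrix_inv B ** Y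
     in (1 / sqrt 3) *\<^sub>R (A ** (\<alpha> - 2 *\<^sub>R \<beta>), B ** (2 *\<^sub>R \<alpha> - \<beta>)))"

definition nk_P :: "mat2 \<times> mat2 \<Rightarrow> mat2 \<times> mat2 \<Rightarrow> mat2 \<times> mat2" where
  "nk_P = (\<lambda>(A, B) (X, Y).
     let \<alpha> = matrix_inv A ** X; \<beta> = matrix_inv B ** Y
     in (A ** \<beta>, B ** \<alpha>))"

definition nk_metric :: "mat2 \<times> mat2 \<Rightarrow> mat2 \<times> mat2 \<Rightarrow> mat2 \<times> mat2 \<Rightarrow> real" where
  "nk_metric p Z Z' = (1 / 4) * (prod_form Z Z' + prod_form (nk_J p Z) (nk_J p Z'))"

lemma mat_form_self: "mat_form X X = - det X"
  by (simp add: mat_form_def det_2 algebra_simps)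

lemma SL2_inv_cancel:
  assumes "A \<in> SL2"
  shows "matrix_inv A ** (A ** X) = X"
proof -
  have "invertible A"
    using assms by (simp add: SL2_def invertible_det_nz)
  then have "matrix_inv A ** A = mat 1"
    unfolding invertible_def matrix_inv_def by (rule someI2_ex) simp
  then show ?thesis
    by (simp add: matrix_mul_assoc)
qed

lemma nk_J_apply:
  assumes "(A, B) \<in> SL2xSL2"
  shows "nk_J (A, B) (A ** \<alpha>, B ** \<beta>) =
    (1 / sqrt 3) *\<^sub>R (A ** (\<alpha> - 2 *\<^sub>R \<beta>), B ** (2 *\<^sub>R \<alpha> - \<beta>))"
  using assms by (simp add: nk_J_def SL2xSL2_def SL2_inv_cancel)

lemma nk_P_apply:
  assumes "(A, B) \<in> SL2xSL2"
  shows "nk_P (A, B) (A ** \<alpha>, B ** \<beta>) = (A ** \<beta>, B ** \<alpha>)"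
  using assms by (simp add: nk_P_def SL2xSL2_def SL2_inv_cancel)

section \<open>Isometries\<close>

text \<open>Smoothness on the embedded submanifold: local existence of a smooth ambient extension.\<close>

definition smooth_on_SL2xSL2 :: "(mat2 \<times> mat2 \<Rightarrow> mat2 \<times> mat2) \<Rightarrow> bool" where
  "smooth_on_SL2xSL2 \<phi> \<longleftrightarrow>
     (\<forall>p\<in>SL2xSL2. \<exists>W h. p \<in> W \<and> smooth_on W h \<and> (\<forall>q\<in>W \<inter> SL2xSL2. h q = \<phi> q))"

text \<open>
  The derivative \<open>D\<close> within the submanifold is not unique as a linear map of the ambient space,
  but its restriction to the tangent space, which is all that is used, is the differential of \<open>\<phi>\<close>.
\<close>

definition nk_isometry :: "(mat2 \<times> mat2 \<Rightarrow> mat2 \<times> mat2) \<Rightarrow> bool" where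
  "nk_isometry \<phi> \<longleftrightarrow>
     bij_betw \<phi> SL2xSL2 SL2xSL2 \<and>
     smooth_on_SL2xSL2 \<phi> \<and> smooth_on_SL2xSL2 (inv_into SL2xSL2 \<phi>) \<and>
     (\<forall>p\<in>SL2xSL2. \<exists>D. (\<phi> has_derivative D) (at p within SL2xSL2) \<and>
        (\<forall>Z\<in>tangent_SL2xSL2 p. \<forall>Z'\<in>tangent_SL2xSL2 p.
           nk_metric (\<phi> p) (D Z) (D Z') = nk_metric p Z Z'))"

section \<open>Immersed surfaces\<close>

definition immersed_surface ::
  "'a topology \<Rightarrow> ('a set \<times> ('a \<Rightarrow> real \<times> real)) set \<Rightarrow> ('a \<Rightarrow> mat2 \<times> mat2) \<Rightarrow> bool" where
  "immersed_surface M \<A> f \<longleftrightarrow>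
     smooth_surface M \<A> \<and> f ` topspace M \<subseteq> SL2xSL2 \<and>
     (\<forall>(U, x)\<in>\<A>. smooth_on (x ` U) (f \<circ> inv_into U x) \<and>
        (\<forall>q\<in>x ` U. inj (frechet_derivative (f \<circ> inv_into U x) (at q))))"

text \<open>
  The tangent plane of the immersed surface at \<open>m\<close>, as a subspace of the tangent space at \<open>f m\<close>.
  All charts around \<open>m\<close> give the same plane, so the union over charts is that plane.
\<close>

definition tangent_plane ::
  "('a set \<times> ('a \<Rightarrow> real \<times> real)) set \<Rightarrow> ('a \<Rightarrow> mat2 \<times> mat2) \<Rightarrow> 'a \<Rightarrow> (mat2 \<times> mat2) set" where
  "tangent_plane \<A> f m =
     (\<Union>(U, x)\<in>{(U, x)\<in>\<A>. m \<in> U}. range (frechet_derivative (f \<circ> inv_into U x) (at (x m))))"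

definition almost_complex_surface ::
  "'a topology \<Rightarrow> ('a set \<times> ('a \<Rightarrow> real \<times> real)) set \<Rightarrow> ('a \<Rightarrow> mat2 \<times> mat2) \<Rightarrow> bool" where
  "almost_complex_surface M \<A> f \<longleftrightarrow>
     (\<forall>m\<in>topspace M. nk_J (f m) ` tangent_plane \<A> f m = tangent_plane \<A> f m)"

definition degenerate_surface ::
  "'a topology \<Rightarrow> ('a set \<times> ('a \<Rightarrow> real \<times> real)) set \<Rightarrow> ('a \<Rightarrow> mat2 \<times> mat2) \<Rightarrow> bool" where
  "degenerate_surface M \<A> f \<longleftrightarrow>
     (\<forall>m\<in>topspace M. \<forall>Z\<in>tangent_plane \<A> f m. \<forall>Z'\<in>tangent_plane \<A> f m.
        nk_metric (f m) Z Z' = 0)"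

definition P_invariant_surface ::
  "'a topology \<Rightarrow> ('a set \<times> ('a \<Rightarrow> real \<times> real)) set \<Rightarrow> ('a \<Rightarrow> mat2 \<times> mat2) \<Rightarrow> bool" where
  "P_invariant_surface M \<A> f \<longleftrightarrow>
     (\<forall>m\<in>topspace M. nk_P (f m) ` tangent_plane \<A> f m = tangent_plane \<A> f m)"

definition locally_congruent_to ::
  "'a topology \<Rightarrow> ('a \<Rightarrow> mat2 \<times> mat2) \<Rightarrow> (real \<times> real \<Rightarrow> mat2 \<times> mat2) \<Rightarrow> bool" where
  "locally_congruent_to M f F \<longleftrightarrow>
     (\<forall>m\<in>topspace M. \<exists>U \<phi> V. openin M U \<and> m \<in> U \<and> nk_isometry \<phi> \<and> open V \<and>
        \<phi> ` f ` U = F ` V)"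

end

theory Submission
  imports Defs
begin

text \<open>
  Trivialize the tangent bundle by left translation. A tangent plane invariant under both \<open>J\<close> and
  \<open>P\<close> is of the form \<open>{(s A\<alpha>, t B\<alpha>)}\<close> for some nonzero \<open>\<alpha>\<close> depending on the
  point, and degeneracy says \<open>det \<alpha> = 0\<close> (\<open>null_tangent_plane\<close>). Hence, in a chart, the
  differentials of the two components \<open>A\<close> and \<open>B\<close> all annihilate the line \<open>ker \<alpha>\<close>.

  The heart of the matter is that this line is locally constant (\<open>common_kernel_constant\<close>). The
  slope \<open>k\<close> of the line satisfies \<open>d(A v) = k d(A w)\<close> and \<open>d(B v) = k d(B w)\<close> for constant vectors
  \<open>v\<close>, \<open>w\<close>. Taking exterior derivatives, which amounts to symmetry of second derivatives, \<open>dk\<close> is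
  proportional to two linearly independent 1-forms and so vanishes. Consequently \<open>A v\<close> and \<open>B v\<close>
  are constant for a fixed nonzero vector \<open>v\<close>.

  The maps \<open>(X, Y) \<mapsto> (a X c, b Y c)\<close> with \<open>a\<close>, \<open>b\<close>, \<open>c\<close> of determinant 1 are isometries
  (\<open>nk_isometry_translation\<close>). With suitable \<open>a\<close>, \<open>b\<close>, \<open>c\<close> both components come to fix the first
  basis vector, so they are unipotent upper triangular matrices. Because the surface is immersed,
  the two upper right entries are local coordinates on it, and a neighbourhood is carried onto an
  open part of the model (\<open>local_congruence\<close>).
\<close>

section \<open>Functions of class \<open>C\<close>-\<open>k\<close> and symmetry of second derivatives\<close>

lemma Ck_on_subset: "Ck_on k S h \<Longrightarrow> T \<subseteq> S \<Longrightarrow> Ck_on k T h"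
  by (induction k arbitrary: h) (auto intro: continuous_on_subset)

lemma Ck_on_const: "Ck_on k S (\<lambda>_. c)"
  by (induction k arbitrary: c) auto

lemma Ck_on_bounded_linear: "bounded_linear h \<Longrightarrow> Ck_on k S h"
proof (cases k)
  case 0
  assume "bounded_linear h" then show ?thesis by (simp add: 0 linear_continuous_on)
next
  case (Suc n)
  assume h: "bounded_linear h"
  then have "(h has_derivative h) (at x)" for x by (rule bounded_linear_imp_has_derivative)
  then show ?thesis using frechet_derivative_at[of h h] Ck_on_const
    by (auto simp: Suc differentiable_def)
qed

text \<open>
  The mean value theorem in the direction \<open>h\<close> and then in the direction \<open>k\<close>. The left-hand side is
  symmetric in \<open>h\<close> and \<open>k\<close>, which is what makes the two orders of differentiation comparable.
\<close>

lemma second_difference_mvt: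
  fixes f :: "'a::real_normed_vector \<Rightarrow> real"
  assumes f: "\<And>y. y \<in> ball x r \<Longrightarrow> (f has_derivative f' y) (at y)"
    and f'': "\<And>y. y \<in> ball x r \<Longrightarrow> ((\<lambda>z. f' z h) has_derivative f'' y) (at y)"
    and t: "0 < t" "t * (norm h + norm k) < r"
  shows "\<exists>y\<in>ball x r. f (x + t *\<^sub>R h + t *\<^sub>R k) - f (x + t *\<^sub>R h) - f (x + t *\<^sub>R k) + f x
           = t\<^sup>2 * f'' y k"
proof -
  have mem: "x + a *\<^sub>R h + b *\<^sub>R k \<in> ball x r" if "0 \<le> a" "a \<le> t" "0 \<le> b" "b \<le> t" for a b
  proof -
    have "norm (a *\<^sub>R h + b *\<^sub>R k) \<le> a * norm h + b * norm k"
      using norm_triangle_ineq[of "a *\<^sub>R h" "b *\<^sub>R k"] that by simp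
    also have "\<dots> \<le> t * norm h + t * norm k"
      using that by (intro add_mono mult_right_mono) auto
    also have "\<dots> < r" using t by (simp add: algebra_simps)
    finally show ?thesis
      using norm_minus_cancel[of "a *\<^sub>R h + b *\<^sub>R k"]
      by (simp add: dist_norm minus_add[symmetric] add.assoc del: norm_minus_cancel)
  qed
  have fd: "((\<lambda>a. f (x + a *\<^sub>R h + b *\<^sub>R k)) has_real_derivative f' (x + a *\<^sub>R h + b *\<^sub>R k) h) (at a)"
    if "0 \<le> a" "a \<le> t" "0 \<le> b" "b \<le> t" for a b
  proof -
    have "((\<lambda>a. f (x + a *\<^sub>R h + b *\<^sub>R k)) has_derivative
             (\<lambda>s. f' (x + a *\<^sub>R h + b *\<^sub>R k) (s *\<^sub>R h))) (at a)"
      by (rule has_derivative_compose[where g = f and f = "\<lambda>a. x + a *\<^sub>R h + b *\<^sub>R k"])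
         (auto intro!: derivative_eq_intros f[OF mem[OF that]])
    moreover have "f' (x + a *\<^sub>R h + b *\<^sub>R k) (s *\<^sub>R h) = f' (x + a *\<^sub>R h + b *\<^sub>R k) h * s" for s
      using linear_cmul[OF has_derivative_linear[OF f[OF mem[OF that]]]] by simp
    ultimately show ?thesis
      by (simp add: has_field_derivative_def)
  qed
  have fdd: "((\<lambda>b. f' (x + a *\<^sub>R h + b *\<^sub>R k) h) has_real_derivative f'' (x + a *\<^sub>R h + b *\<^sub>R k) k) (at b)"
    if "0 \<le> a" "a \<le> t" "0 \<le> b" "b \<le> t" for a b
  proof -
    have "((\<lambda>b. f' (x + a *\<^sub>R h + b *\<^sub>R k) h) has_derivative
             (\<lambda>s. f'' (x + a *\<^sub>R h + b *\<^sub>R k) (s *\<^sub>R k))) (at b)"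
      by (rule has_derivative_compose[where g = "\<lambda>z. f' z h" and f = "\<lambda>b. x + a *\<^sub>R h + b *\<^sub>R k"])
         (auto intro!: derivative_eq_intros f''[OF mem[OF that]])
    moreover have "f'' (x + a *\<^sub>R h + b *\<^sub>R k) (s *\<^sub>R k) = f'' (x + a *\<^sub>R h + b *\<^sub>R k) k * s" for s
      using linear_cmul[OF has_derivative_linear[OF f''[OF mem[OF that]]]] by simp
    ultimately show ?thesis
      by (simp add: has_field_derivative_def)
  qed
  have "\<exists>a. 0 < a \<and> a < t \<and>
      (\<lambda>a. f (x + a *\<^sub>R h + t *\<^sub>R k) - f (x + a *\<^sub>R h + 0 *\<^sub>R k)) t -
      (\<lambda>a. f (x + a *\<^sub>R h + t *\<^sub>R k) - f (x + a *\<^sub>R h + 0 *\<^sub>R k)) 0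
    = (t - 0) * (f' (x + a *\<^sub>R h + t *\<^sub>R k) h - f' (x + a *\<^sub>R h + 0 *\<^sub>R k) h)"
    by (intro MVT2 DERIV_diff fd) (use t in auto)
  then obtain a where a: "0 < a" "a < t" and
    ea: "f (x + t *\<^sub>R h + t *\<^sub>R k) - f (x + t *\<^sub>R h) - (f (x + t *\<^sub>R k) - f x)
      = t * (f' (x + a *\<^sub>R h + t *\<^sub>R k) h - f' (x + a *\<^sub>R h) h)"
    by auto
  have "\<exists>b. 0 < b \<and> b < t \<and>
      f' (x + a *\<^sub>R h + t *\<^sub>R k) h - f' (x + a *\<^sub>R h + 0 *\<^sub>R k) h
    = (t - 0) * f'' (x + a *\<^sub>R h + b *\<^sub>R k) k"
    by (intro MVT2[of _ _ "\<lambda>b. f' (x + a *\<^sub>R h + b *\<^sub>R k) h"] fdd) (use t a in auto)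
  then obtain b where b: "0 < b" "b < t" and
    eb: "f' (x + a *\<^sub>R h + t *\<^sub>R k) h - f' (x + a *\<^sub>R h) h = t * f'' (x + a *\<^sub>R h + b *\<^sub>R k) k"
    by auto
  show ?thesis
    by (rule bexI[OF _ mem[of a b]]) (use ea eb a b in \<open>auto simp: power2_eq_square\<close>)
qed

text \<open>
  By the previous lemma both second derivatives are approximated by the same second difference
  divided by \<open>t\<^sup>2\<close>, so by continuity they cannot differ at \<open>x\<close>.
\<close>

lemma symmetric_second_derivative_real:
  fixes f :: "'a::real_normed_vector \<Rightarrow> real"
  assumes "open S" "x \<in> S"
    and f: "\<And>y. y \<in> S \<Longrightarrow> (f has_derivative f' y) (at y)"
    and fh: "\<And>y. y \<in> S \<Longrightarrow> ((\<lambda>z. f' z h) has_derivative fh y) (at y)"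
    and fk: "\<And>y. y \<in> S \<Longrightarrow> ((\<lambda>z. f' z k) has_derivative fk y) (at y)"
    and ch: "continuous_on S (\<lambda>y. fh y k)" and ck: "continuous_on S (\<lambda>y. fk y h)"
  shows "fh x k = fk x h"
proof (rule ccontr)
  assume ne: "fh x k \<noteq> fk x h"
  define e where "e = \<bar>fh x k - fk x h\<bar> / 2"
  have e: "e > 0" using ne by (simp add: e_def)
  have "isCont (\<lambda>y. fh y k) x" "isCont (\<lambda>y. fk y h) x"
    using ch ck assms(1,2) continuous_on_eq_continuous_at by blast+
  then obtain d1 d2 where d: "d1 > 0" "d2 > 0"
    "\<And>y. dist y x < d1 \<Longrightarrow> dist (fh y k) (fh x k) < e"
    "\<And>y. dist y x < d2 \<Longrightarrow> dist (fk y h) (fk x h) < e"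
    unfolding continuous_at_eps_delta using e by metis
  obtain d3 where d3: "d3 > 0" "ball x d3 \<subseteq> S"
    using assms(1,2) open_contains_ball by blast
  define r where "r = min d1 (min d2 d3)"
  have r: "r > 0" "ball x r \<subseteq> S" using d d3 by (auto simp: r_def)
  \<comment> \<open>small enough for the parallelogram spanned by \<open>t h\<close> and \<open>t k\<close> at \<open>x\<close> to fit into the ball\<close>
  define t where "t = r / (norm h + norm k + 1)"
  have pos: "norm h + norm k + 1 > 0" by (simp add: add_nonneg_pos)
  have t: "t > 0" "t * (norm h + norm k) < r"
    using r pos by (auto simp: t_def field_simps add_nonneg_pos)
  obtain y where y: "y \<in> ball x r" "f (x + t *\<^sub>R h + t *\<^sub>R k) - f (x + t *\<^sub>R h) - f (x + t *\<^sub>R k) + f x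
           = t\<^sup>2 * fh y k"
    using second_difference_mvt[of x r f f' h fh t k] f fh t r by blast
  obtain z where z: "z \<in> ball x r" "f (x + t *\<^sub>R k + t *\<^sub>R h) - f (x + t *\<^sub>R k) - f (x + t *\<^sub>R h) + f x
           = t\<^sup>2 * fk z h"
    using second_difference_mvt[of x r f f' k fk t h] f fk t r by (metis add.commute subsetD)
  have "t\<^sup>2 * fh y k = t\<^sup>2 * fk z h"
    unfolding y(2)[symmetric] z(2)[symmetric] by (simp add: algebra_simps)
  then have "fh y k = fk z h" using t by simp
  moreover have "\<bar>fh y k - fh x k\<bar> < e" "\<bar>fk z h - fk x h\<bar> < e"
    using d(3)[of y] d(4)[of z] y(1) z(1) by (auto simp: r_def dist_commute dist_real_def)
  ultimately show False unfolding e_def by (smt (verit) field_sum_of_halves)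
qed

lemma symmetric_second_derivative:
  fixes f :: "'a::euclidean_space \<Rightarrow> 'b::euclidean_space"
  assumes "open S" "x \<in> S" and C2: "Ck_on 2 S f"
  shows "frechet_derivative (\<lambda>y. frechet_derivative f (at y) h) (at x) k =
         frechet_derivative (\<lambda>y. frechet_derivative f (at y) k) (at x) h"
proof (rule euclidean_eqI)
  fix b :: 'b
  have 1: "\<And>y. y \<in> S \<Longrightarrow> (f has_derivative frechet_derivative f (at y)) (at y)"
    and 2: "\<And>y v. y \<in> S \<Longrightarrow> ((\<lambda>y. frechet_derivative f (at y) v) has_derivative
          frechet_derivative (\<lambda>y. frechet_derivative f (at y) v) (at y)) (at y)"
    and 3: "\<And>v w. continuous_on S (\<lambda>y. frechet_derivative (\<lambda>y. frechet_derivative f (at y) v) (at y) w)"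
    using C2 by (auto simp: numeral_2_eq_2 frechet_derivative_works)
  show "frechet_derivative (\<lambda>y. frechet_derivative f (at y) h) (at x) k \<bullet> b =
         frechet_derivative (\<lambda>y. frechet_derivative f (at y) k) (at x) h \<bullet> b"
    by (rule symmetric_second_derivative_real[OF assms(1,2), where f = "\<lambda>y. f y \<bullet> b"
          and f' = "\<lambda>y v. frechet_derivative f (at y) v \<bullet> b"])
       (intro has_derivative_inner_left 1 2 continuous_intros 3; assumption)+
qed

text \<open>
  In the language of differential forms: if \<open>dF = k dG\<close> with \<open>F = L1 \<circ> g\<close> and \<open>G = L2 \<circ> g\<close>, then
  \<open>0 = d(dF) = dk \<and> dG\<close>. The conclusion is this identity evaluated on \<open>h\<close> and \<open>h'\<close>; the terms with
  second derivatives of \<open>g\<close> cancel by symmetry.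
\<close>

lemma slope_differential:
  fixes g :: "'a::euclidean_space \<Rightarrow> 'b::euclidean_space" and L1 L2 :: "'b \<Rightarrow> 'c::real_normed_vector"
  assumes "open S" "x \<in> S" and C2: "Ck_on 2 S g"
    and L: "bounded_linear L1" "bounded_linear L2"
    and k: "(k has_derivative k') (at x)"
    and eq: "\<And>y h. y \<in> S \<Longrightarrow> L1 (frechet_derivative g (at y) h) = k y *\<^sub>R L2 (frechet_derivative g (at y) h)"
  shows "k' h *\<^sub>R L2 (frechet_derivative g (at x) h') = k' h' *\<^sub>R L2 (frechet_derivative g (at x) h)"
proof -
  define D where "D = (\<lambda>h y. frechet_derivative g (at y) h)"
  define D2 where "D2 = (\<lambda>h. frechet_derivative (D h) (at x))"
  have D: "(D h has_derivative D2 h) (at x)" for h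
    using C2 assms(2) by (auto simp: numeral_2_eq_2 frechet_derivative_works D_def D2_def)
  have sym: "D2 h h' = D2 h' h" for h h'
    using symmetric_second_derivative[OF assms(1,2) C2] by (simp add: D2_def D_def)
  have *: "L1 (D2 h h') = k x *\<^sub>R L2 (D2 h h') + k' h' *\<^sub>R L2 (D h x)" for h h'
  proof -
    have 1: "((\<lambda>y. L1 (D h y)) has_derivative (\<lambda>v. L1 (D2 h v))) (at x)"
      by (rule bounded_linear.has_derivative[OF L(1) D])
    have "((\<lambda>y. k y *\<^sub>R L2 (D h y)) has_derivative
        (\<lambda>v. k x *\<^sub>R L2 (D2 h v) + k' v *\<^sub>R L2 (D h x))) (at x)"
      by (intro has_derivative_scaleR k bounded_linear.has_derivative[OF L(2) D])
    then have 2: "((\<lambda>y. L1 (D h y)) has_derivative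
        (\<lambda>v. k x *\<^sub>R L2 (D2 h v) + k' v *\<^sub>R L2 (D h x))) (at x)"
      by (rule has_derivative_transform_within_open[OF _ assms(1,2)]) (simp add: eq D_def)
    show ?thesis using fun_cong[OF has_derivative_unique[OF 1 2], of h'] .
  qed
  show ?thesis using *[of h h'] *[of h' h] sym[of h h'] by (simp add: D_def)
qed

section \<open>Real two by two matrices\<close>

lemma bounded_bilinear_matrix_mul:
  "bounded_bilinear ((**) :: real^'n^'m \<Rightarrow> real^'p^'n \<Rightarrow> real^'p^'m)"
  unfolding bilinear_conv_bounded_bilinear[symmetric] bilinear_def
  by (auto intro!: linearI simp: matrix_matrix_mult_def vec_eq_iff sum.distrib sum_distrib_left
      distrib_left distrib_right mult_ac)

lemmas matrix_mul_bilinear =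
  bounded_bilinear.add_left[OF bounded_bilinear_matrix_mul]
  bounded_bilinear.add_right[OF bounded_bilinear_matrix_mul]
  bounded_bilinear.diff_left[OF bounded_bilinear_matrix_mul]
  bounded_bilinear.diff_right[OF bounded_bilinear_matrix_mul]
  bounded_bilinear.minus_left[OF bounded_bilinear_matrix_mul]
  bounded_bilinear.minus_right[OF bounded_bilinear_matrix_mul]
  bounded_bilinear.scaleR_left[OF bounded_bilinear_matrix_mul]
  bounded_bilinear.scaleR_right[OF bounded_bilinear_matrix_mul]

lemma SL2_inverse:
  assumes "A \<in> SL2"
  shows "matrix_inv A ** A = mat 1" "A ** matrix_inv A = mat 1" "matrix_inv A \<in> SL2"
proof -
  have "invertible A"
    using assms by (simp add: SL2_def invertible_det_nz)
  then have "A ** matrix_inv A = mat 1 \<and> matrix_inv A ** A = mat 1"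
    unfolding invertible_def matrix_inv_def by (rule someI_ex)
  then show *: "matrix_inv A ** A = mat 1" "A ** matrix_inv A = mat 1" by auto
  have "det (matrix_inv A) * det A = 1"
    by (metis * det_I det_mul)
  then show "matrix_inv A \<in> SL2" using assms by (simp add: SL2_def)
qed

lemma SL2_mult: "A \<in> SL2 \<Longrightarrow> B \<in> SL2 \<Longrightarrow> A ** B \<in> SL2"
  by (simp add: SL2_def det_mul)

lemma SL2_mult_eq_0: "A \<in> SL2 \<Longrightarrow> A ** X = 0 \<longleftrightarrow> X = 0"
  by (metis SL2_inv_cancel times0_right)

lemma SL2_mult_vec_eq_0: "A \<in> SL2 \<Longrightarrow> A *v x = 0 \<longleftrightarrow> x = 0"
  by (metis SL2_inverse(1) matrix_vector_mul_assoc matrix_vector_mul_lid matrix_vector_mult_0_right)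

lemma singular_matrix_kernel:
  fixes \<alpha> :: "real^'n^'n"
  assumes "det \<alpha> = 0"
  shows "\<exists>v. v \<noteq> 0 \<and> \<alpha> *v v = 0"
proof -
  have "\<not> (\<exists>N. N ** \<alpha> = mat 1)"
    using assms by (metis det_I det_mul mult_zero_right zero_neq_one)
  then show ?thesis using matrix_left_invertible_ker[of \<alpha>] by blast
qed

text \<open>
  The witness is the rotation whose columns are \<open>v\<close> and \<open>v\<close> turned by a right angle, both normalized.
\<close>

lemma SL2_first_column:
  fixes v :: "real^2"
  assumes "v \<noteq> 0"
  shows "\<exists>C\<in>SL2. \<exists>r. r \<noteq> 0 \<and> C *v axis 1 1 = r *\<^sub>R v"
proof -
  let ?C = "vector [vector [v$1 / norm v, - v$2 / norm v], vector [v$2 / norm v, v$1 / norm v]] :: mat2"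
  have n: "(norm v)\<^sup>2 = v$1 * v$1 + v$2 * v$2"
    by (simp add: power2_norm_eq_inner inner_vec_def sum_2)
  have "det ?C = (v$1 * v$1 + v$2 * v$2) / (norm v)\<^sup>2"
    by (simp add: det_2 power2_eq_square add_divide_distrib)
  then have "?C \<in> SL2" using assms unfolding SL2_def n[symmetric] by simp
  moreover have "?C *v axis 1 1 = (1 / norm v) *\<^sub>R v"
    by (simp add: vec_eq_iff forall_2 matrix_vector_mult_def sum_2 axis_def)
  ultimately show ?thesis using assms by (intro bexI[of _ ?C] exI[of _ "1 / norm v"]) auto
qed

section \<open>Isometries by translation\<close>

lemma mat_form_mult:
  "mat_form (a ** X ** c) (a ** Y ** c) = det a * det c * mat_form X Y"
  by (simp add: mat_form_def det_2 matrix_matrix_mult_def sum_2 algebra_simps)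

text \<open>
  The two factors may be multiplied on the left by different matrices, but on the right only by a
  common one: right multiplication by \<open>c\<close> conjugates the left-trivialized vectors \<open>\<alpha>\<close> and \<open>\<beta>\<close> by
  \<open>c\<close>, and \<open>J\<close> mixes \<open>\<alpha>\<close> with \<open>\<beta>\<close>, so both have to undergo the same conjugation. Then the map
  commutes with \<open>J\<close>, and it preserves the product form because the determinant is multiplicative.
\<close>

lemma nk_isometry_translation:
  assumes a: "a \<in> SL2" and b: "b \<in> SL2" and c: "c \<in> SL2"
  shows "nk_isometry (\<lambda>(X, Y). (a ** X ** c, b ** Y ** c))"
proof -
  define T :: "mat2 \<Rightarrow> mat2 \<Rightarrow> mat2 \<Rightarrow> mat2 \<times> mat2 \<Rightarrow> mat2 \<times> mat2"
    where "T = (\<lambda>a b c. \<lambda>(X, Y). (a ** X ** c, b ** Y ** c))"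
  have bl: "bounded_linear (T a b c)" for a b c
    unfolding T_def
    by (auto intro!: linearI simp: linear_conv_bounded_linear[symmetric] matrix_mul_bilinear)
  have sm: "smooth_on UNIV (T a b c)" for a b c
    by (simp add: smooth_on_def Ck_on_bounded_linear[OF bl])
  have TT: "T a b c (T a' b' c' p) = p"
    if "a ** a' = mat 1" "b ** b' = mat 1" "c' ** c = mat 1" for a b c a' b' c' p
  proof -
    have "a ** (a' ** X ** c') ** c = (a ** a') ** X ** (c' ** c)" for a a' X :: mat2
      by (simp add: matrix_mul_assoc)
    then show ?thesis using that by (cases p) (simp add: T_def)
  qed
  let ?a = "matrix_inv a" and ?b = "matrix_inv b" and ?c = "matrix_inv c"
  have inv: "T a b c (T ?a ?b ?c p) = p" "T ?a ?b ?c (T a b c p) = p" for p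
    using assms by (auto intro!: TT SL2_inverse)
  have map: "T a b c p \<in> SL2xSL2" if "a \<in> SL2" "b \<in> SL2" "c \<in> SL2" "p \<in> SL2xSL2" for a b c p
    using that by (auto simp: T_def SL2xSL2_def SL2_mult)
  have bij: "bij_betw (T a b c) SL2xSL2 SL2xSL2"
    by (rule bij_betw_byWitness[where f' = "T ?a ?b ?c"])
       (use inv map assms SL2_inverse(3) in auto)
  have invinto: "inv_into SL2xSL2 (T a b c) p = T ?a ?b ?c p" if "p \<in> SL2xSL2" for p
    using bij inv map assms SL2_inverse(3) that
    by (intro inv_into_f_eq) (auto simp: bij_betw_def)
  have J: "nk_J (T a b c p) (T a b c Z) = T a b c (nk_J p Z)"
    if "p \<in> SL2xSL2" for p Z
  proof -
    obtain A B where p: "p = (A, B)" by fastforce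
    then have A: "A \<in> SL2" and B: "B \<in> SL2" using that by (auto simp: SL2xSL2_def)
    define \<alpha> \<beta> where "\<alpha> = matrix_inv A ** fst Z" and "\<beta> = matrix_inv B ** snd Z"
    have Z: "Z = (A ** \<alpha>, B ** \<beta>)"
      using A B by (simp add: \<alpha>_def \<beta>_def matrix_mul_assoc SL2_inverse)
    \<comment> \<open>the left-trivialized vector \<open>X\<close> at \<open>A\<close> becomes \<open>?c ** X ** c\<close> at \<open>a ** A ** c\<close>\<close>
    have shift: "a ** (A ** X) ** c = (a ** A ** c) ** (?c ** X ** c)" for a A X
    proof -
      have "(a ** A ** c) ** (?c ** X ** c) = a ** A ** (c ** ?c) ** X ** c"
        by (simp add: matrix_mul_assoc)
      then show ?thesis using c by (simp add: SL2_inverse matrix_mul_assoc)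
    qed
    have "nk_J (T a b c p) (T a b c Z) =
      nk_J (a ** A ** c, b ** B ** c) ((a ** A ** c) ** (?c ** \<alpha> ** c), (b ** B ** c) ** (?c ** \<beta> ** c))"
      by (simp add: T_def p Z shift)
    also have "\<dots> = (1 / sqrt 3) *\<^sub>R ((a ** A ** c) ** (?c ** \<alpha> ** c - 2 *\<^sub>R (?c ** \<beta> ** c)),
       (b ** B ** c) ** (2 *\<^sub>R (?c ** \<alpha> ** c) - (?c ** \<beta> ** c)))"
      by (rule nk_J_apply) (use A B assms in \<open>auto simp: SL2xSL2_def SL2_mult\<close>)
    also have "\<dots> = (1 / sqrt 3) *\<^sub>R ((a ** A ** c) ** (?c ** (\<alpha> - 2 *\<^sub>R \<beta>) ** c),
       (b ** B ** c) ** (?c ** (2 *\<^sub>R \<alpha> - \<beta>) ** c))"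
      by (simp add: matrix_mul_bilinear)
    also have "\<dots> = T a b c (nk_J p Z)"
      using that unfolding shift[symmetric]
      by (simp add: T_def p Z nk_J_apply matrix_mul_bilinear)
    finally show ?thesis .
  qed
  have prod: "prod_form (T a b c Z) (T a b c Z') = prod_form Z Z'" for Z Z'
    using assms by (cases Z; cases Z') (simp add: T_def prod_form_def mat_form_mult SL2_def)
  have metric: "nk_metric (T a b c p) (T a b c Z) (T a b c Z') = nk_metric p Z Z'"
    if "p \<in> SL2xSL2" for p Z Z'
    using that by (simp add: nk_metric_def J prod)
  have "smooth_on_SL2xSL2 (T a b c)" "smooth_on_SL2xSL2 (inv_into SL2xSL2 (T a b c))"
    unfolding smooth_on_SL2xSL2_def using sm invinto by (metis IntD2 UNIV_I)+
  moreover have "\<forall>p\<in>SL2xSL2. \<exists>D. (T a b c has_derivative D) (at p within SL2xSL2) \<and>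
        (\<forall>Z\<in>tangent_SL2xSL2 p. \<forall>Z'\<in>tangent_SL2xSL2 p.
           nk_metric (T a b c p) (D Z) (D Z') = nk_metric p Z Z')"
    using metric bounded_linear_imp_has_derivative[OF bl] by blast
  ultimately have "nk_isometry (T a b c)" using bij by (simp add: nk_isometry_def)
  then show ?thesis by (simp add: T_def)
qed

section \<open>Tangent planes\<close>

text \<open>
  Since \<open>P\<close> is an involution anticommuting with \<open>J\<close>, both its eigenvalues occur in an invariant
  plane. A fixed vector of \<open>P\<close> has the form \<open>(A\<alpha>, B\<alpha>)\<close>, and \<open>J\<close> sends it to a multiple of
  \<open>(- A\<alpha>, B\<alpha>)\<close>; together they span the plane. The metric on \<open>(A\<alpha>, B\<alpha>)\<close> is a nonzero multiple
  of \<open>det \<alpha>\<close>, so degeneracy makes \<open>\<alpha>\<close> singular.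
\<close>

lemma null_tangent_plane:
  fixes D :: "real \<times> real \<Rightarrow> mat2 \<times> mat2"
  assumes AB: "(A, B) \<in> SL2xSL2"
    and D: "linear D" "inj D"
    and J: "nk_J (A, B) ` range D = range D"
    and P: "nk_P (A, B) ` range D = range D"
    and null: "\<And>Z. Z \<in> range D \<Longrightarrow> nk_metric (A, B) Z Z = 0"
  shows "\<exists>\<alpha>. \<alpha> \<noteq> 0 \<and> det \<alpha> = 0 \<and>
    range D = {(a *\<^sub>R (A ** \<alpha>), b *\<^sub>R (B ** \<alpha>)) | a b. True}"
proof -
  have A: "A \<in> SL2" and B: "B \<in> SL2" using AB by (auto simp: SL2xSL2_def)
  have sub: "subspace (range D)" using D(1) by (simp add: linear_subspace_image)
  have JD: "nk_J (A, B) Z \<in> range D" and PD: "nk_P (A, B) Z \<in> range D" if "Z \<in> range D" for Z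
    using J P that by blast+
  define Z where "Z = D (1, 0)"
  have Z: "Z \<in> range D" "Z \<noteq> 0"
    using linear_injective_0[OF D(1)] D(2) unfolding Z_def by (force simp: zero_prod_def)+
  define \<beta> \<gamma> where "\<beta> = matrix_inv A ** fst Z" and "\<gamma> = matrix_inv B ** snd Z"
  have Zeq: "Z = (A ** \<beta>, B ** \<gamma>)"
    using A B by (simp add: \<beta>_def \<gamma>_def matrix_mul_assoc SL2_inverse)
  \<comment> \<open>either \<open>Z + P Z\<close> is a nonzero fixed vector of \<open>P\<close>, or \<open>P Z = - Z\<close> and \<open>J Z\<close> is one\<close>
  have "\<exists>\<alpha>. \<alpha> \<noteq> 0 \<and> (A ** \<alpha>, B ** \<alpha>) \<in> range D"
  proof (cases "\<beta> + \<gamma> = 0")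
    case False
    have "Z + nk_P (A, B) Z \<in> range D" using Z sub PD by (simp add: subspace_add)
    then show ?thesis using False
      by (auto simp: Zeq nk_P_apply[OF AB] matrix_mul_bilinear(2)[symmetric] add.commute)
  next
    case True
    then have \<gamma>: "\<gamma> = - \<beta>" by (simp add: eq_neg_iff_add_eq_0 add.commute)
    then have "\<beta> \<noteq> 0" using Z(2) by (auto simp: Zeq zero_prod_def)
    have eq: "\<beta> - 2 *\<^sub>R \<gamma> = 3 *\<^sub>R \<beta>" "2 *\<^sub>R \<beta> - \<gamma> = 3 *\<^sub>R \<beta>"
      by (simp_all add: \<gamma> vec_eq_iff)
    have "(sqrt 3 / 3) *\<^sub>R nk_J (A, B) Z \<in> range D" using JD[OF Z(1)] sub by (rule subspace_scale[rotated])
    then show ?thesis using \<open>\<beta> \<noteq> 0\<close>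
      by (auto simp: Zeq nk_J_apply[OF AB] eq matrix_mul_bilinear)
  qed
  then obtain \<alpha> where \<alpha>: "\<alpha> \<noteq> 0" "(A ** \<alpha>, B ** \<alpha>) \<in> range D" by blast
  have eq: "\<alpha> - 2 *\<^sub>R \<alpha> = - \<alpha>" "2 *\<^sub>R \<alpha> - \<alpha> = \<alpha>" by (simp_all add: vec_eq_iff)
  have J\<alpha>: "nk_J (A, B) (A ** \<alpha>, B ** \<alpha>) = (1 / sqrt 3) *\<^sub>R (- (A ** \<alpha>), B ** \<alpha>)"
    unfolding nk_J_apply[OF AB] eq by (simp add: matrix_mul_bilinear)
  have "sqrt 3 *\<^sub>R nk_J (A, B) (A ** \<alpha>, B ** \<alpha>) \<in> range D"
    using JD[OF \<alpha>(2)] sub by (rule subspace_scale[rotated])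
  then have m: "(- (A ** \<alpha>), B ** \<alpha>) \<in> range D" unfolding J\<alpha> by simp
  have e1: "(A ** \<alpha>, 0) \<in> range D"
    using subspace_scale[OF sub subspace_diff[OF sub \<alpha>(2) m], of "1/2"]
    by (simp add: scaleR_2[symmetric])
  have e2: "(0, B ** \<alpha>) \<in> range D"
    using subspace_scale[OF sub subspace_add[OF sub \<alpha>(2) m], of "1/2"]
    by (simp add: scaleR_2[symmetric])
  have nz: "A ** \<alpha> \<noteq> 0" "B ** \<alpha> \<noteq> 0" using \<alpha> A B SL2_mult_eq_0 by auto
  have det: "det \<alpha> = 0"
  proof -
    have "prod_form (A ** \<alpha>, B ** \<alpha>) (A ** \<alpha>, B ** \<alpha>) = - 2 * det \<alpha>"
      using A B by (simp add: prod_form_def mat_form_self det_mul SL2_def)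
    moreover have "det (c *\<^sub>R M) = c\<^sup>2 * det M" for c and M :: mat2
      by (simp add: det_2 power2_eq_square algebra_simps)
    then have "prod_form (nk_J (A, B) (A ** \<alpha>, B ** \<alpha>)) (nk_J (A, B) (A ** \<alpha>, B ** \<alpha>)) = - 2/3 * det \<alpha>"
      using A B unfolding nk_J_apply[OF AB] eq
      by (simp add: prod_form_def mat_form_self det_mul SL2_def power_divide) (simp add: det_2)
    ultimately show ?thesis using null[OF \<alpha>(2)] by (simp add: nk_metric_def)
  qed
  let ?E = "{(A ** \<alpha>, 0), (0, B ** \<alpha>)}"
  have ind: "independent ?E"
    using nz by (auto simp: independent_insert span_singleton zero_prod_def)
  have "dim (range D) = 2" using dim_image_eq[OF D(1), of UNIV] D(2) by (simp add: span_UNIV)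
  moreover have "card ?E = 2" using nz by simp
  ultimately have "range D \<subseteq> span ?E"
    using ind e1 e2 by (intro card_ge_dim_independent) auto
  moreover have "span ?E \<subseteq> range D" using e1 e2 sub by (intro span_minimal) auto
  ultimately have "range D = span ?E" by blast
  also have "\<dots> = {(a *\<^sub>R (A ** \<alpha>), b *\<^sub>R (B ** \<alpha>)) | a b. True}"
    unfolding span_insert span_singleton
    by (auto simp: image_iff)
  finally show ?thesis using \<alpha>(1) det by blast
qed

section \<open>The kernel line is constant\<close>

text \<open>
  All differentials of both components at \<open>q\<close> kill the line \<open>ker \<alpha>\<close>, where \<open>\<alpha>\<close> depends on \<open>q\<close>.
  Write the line near \<open>q0\<close> as spanned by \<open>v - k w\<close> with a function \<open>k\<close>. For the two components
  \<open>A\<close> and \<open>B\<close> of \<open>g\<close> this means \<open>d(A v) = k d(A w)\<close> and \<open>d(B v) = k d(B w)\<close>, hence \<open>dk\<close> is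
  proportional both to the 1-form underlying \<open>dA\<close> and to the one underlying \<open>dB\<close>. These two are
  linearly independent, since \<open>dg\<close> takes values with either component zero and the other one not.
  So \<open>dk = 0\<close>, the line does not move, and \<open>A v\<close>, \<open>B v\<close> have zero derivative.
\<close>

lemma common_kernel_constant:
  fixes g :: "'a::euclidean_space \<Rightarrow> mat2 \<times> mat2"
  assumes S: "open S" "q0 \<in> S" and C2: "Ck_on 2 S g"
    and SL: "\<And>q. q \<in> S \<Longrightarrow> g q \<in> SL2xSL2"
    and plane: "\<And>q. q \<in> S \<Longrightarrow> \<exists>\<alpha>. \<alpha> \<noteq> 0 \<and> det \<alpha> = 0 \<and>
      range (frechet_derivative g (at q)) =
        {(a *\<^sub>R (fst (g q) ** \<alpha>), b *\<^sub>R (snd (g q) ** \<alpha>)) | a b. True}"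
  shows "\<exists>v e. v \<noteq> 0 \<and> e > 0 \<and> ball q0 e \<subseteq> S \<and>
    (\<forall>q\<in>ball q0 e. fst (g q) *v v = fst (g q0) *v v \<and> snd (g q) *v v = snd (g q0) *v v)"
proof -
  define D where "D = (\<lambda>q. frechet_derivative g (at q))"
  have D: "(g has_derivative D q) (at q)"
    and DD: "(\<lambda>q. D q h) differentiable (at q)" if "q \<in> S" for q h
    using C2 that by (auto simp: numeral_2_eq_2 frechet_derivative_works[symmetric] D_def)
  have blf: "bounded_linear (\<lambda>p::mat2\<times>mat2. fst p *v x)"
    and bls: "bounded_linear (\<lambda>p::mat2\<times>mat2. snd p *v x)" for x
    unfolding linear_conv_bounded_linear[symmetric]
    by (auto intro!: linearI simp: algebra_simps scaleR_matrix_vector_assoc)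
  obtain \<alpha>0 where \<alpha>0: "\<alpha>0 \<noteq> 0" "det \<alpha>0 = 0"
    "range (D q0) = {(a *\<^sub>R (fst (g q0) ** \<alpha>0), b *\<^sub>R (snd (g q0) ** \<alpha>0)) | a b. True}"
    using plane[OF S(2)] unfolding D_def by blast
  obtain v where v: "v \<noteq> 0" "\<alpha>0 *v v = 0" using singular_matrix_kernel[OF \<alpha>0(2)] by blast
  define w :: "real^2" where "w = vector [- v$2, v$1]"
  have vw: "\<exists>a b. x = a *\<^sub>R v + b *\<^sub>R w" for x
  proof -
    have n: "v$1 * v$1 + v$2 * v$2 \<noteq> 0"
      using v(1) by (auto simp: vec_eq_iff forall_2 sum_squares_eq_zero_iff)
    have "x = ((x$1 * v$1 + x$2 * v$2) / (v$1 * v$1 + v$2 * v$2)) *\<^sub>R v +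
      ((x$2 * v$1 - x$1 * v$2) / (v$1 * v$1 + v$2 * v$2)) *\<^sub>R w"
      using n by (simp add: vec_eq_iff forall_2 w_def divide_simps) (auto simp: algebra_simps)
    then show ?thesis by blast
  qed
  have "\<alpha>0 *v w \<noteq> 0"
  proof
    assume "\<alpha>0 *v w = 0"
    then have "\<alpha>0 *v x = 0 *v x" for x
      using vw[of x] v(2) by (auto simp: matrix_vector_right_distrib matrix_vector_mult_scaleR)
    then show False using \<alpha>0(1) by (simp add: matrix_eq)
  qed
  have "(fst (g q0) ** \<alpha>0, 0) \<in> range (D q0)"
    unfolding \<alpha>0(3) by (rule CollectI, rule exI[of _ 1], rule exI[of _ 0]) simp
  then obtain h1 where h1: "D q0 h1 = (fst (g q0) ** \<alpha>0, 0)" by (metis imageE)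
  define u where "u = (\<lambda>q. fst (D q h1) *v w)"
  \<comment> \<open>the only candidate for the slope, in a form that is visibly differentiable where \<open>u\<close> is not zero\<close>
  define k where "k = (\<lambda>q. ((fst (D q h1) *v v) \<bullet> u q) / (u q \<bullet> u q))"
  have A0: "fst (g q0) \<in> SL2" using SL[OF S(2)] by (auto simp: SL2xSL2_def)
  have u0: "u q0 \<noteq> 0"
    using \<open>\<alpha>0 *v w \<noteq> 0\<close> SL2_mult_vec_eq_0[OF A0]
    by (simp add: u_def h1 matrix_vector_mul_assoc[symmetric])
  have k0: "k q0 = 0"
    by (simp add: k_def h1 matrix_vector_mul_assoc[symmetric] v)
  have diff: "(\<lambda>q. fst (D q h1) *v x) differentiable (at q)" if "q \<in> S" for q x
    using DD[OF that, of h1] bounded_linear.has_derivative[OF blf] unfolding differentiable_def by blast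
  have "continuous (at q0) u"
    using differentiable_imp_continuous_within[OF diff[OF S(2)]] by (simp add: u_def)
  then obtain e1 where e1: "e1 > 0" "\<And>q. q \<in> ball q0 e1 \<Longrightarrow> u q \<noteq> 0"
    using continuous_at_avoid[of q0 u 0] u0 by (auto simp: dist_commute)
  obtain e2 where e2: "e2 > 0" "ball q0 e2 \<subseteq> S" using S open_contains_ball by blast
  define e where "e = min e1 e2"
  have e: "e > 0" "ball q0 e \<subseteq> S" "\<And>q. q \<in> ball q0 e \<Longrightarrow> u q \<noteq> 0"
    using e1 e2 by (auto simp: e_def)
  have slope: "(\<forall>h. fst (D q h) *v v = k q *\<^sub>R (fst (D q h) *v w) \<and>
            snd (D q h) *v v = k q *\<^sub>R (snd (D q h) *v w)) \<and>
      (\<exists>a. fst (D q a) *v w \<noteq> 0 \<and> snd (D q a) = 0) \<and>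
      (\<exists>b. fst (D q b) = 0 \<and> snd (D q b) *v w \<noteq> 0)"
    if q: "q \<in> ball q0 e" for q
  proof -
    have AB: "fst (g q) \<in> SL2" "snd (g q) \<in> SL2"
      using SL e(2) q by (fastforce simp: SL2xSL2_def)+
    obtain \<alpha> where \<alpha>: "\<alpha> \<noteq> 0" "det \<alpha> = 0"
      "range (D q) = {(a *\<^sub>R (fst (g q) ** \<alpha>), b *\<^sub>R (snd (g q) ** \<alpha>)) | a b. True}"
      using plane q e(2) unfolding D_def by blast
    have form: "\<exists>s t. D q h = (s *\<^sub>R (fst (g q) ** \<alpha>), t *\<^sub>R (snd (g q) ** \<alpha>))" for h
      using rangeI[of "D q" h] unfolding \<alpha>(3) by blast
    have app: "(s *\<^sub>R (A ** \<alpha>)) *v x = s *\<^sub>R (A *v (\<alpha> *v x))" for s A x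
      by (simp add: matrix_vector_mul_assoc scaleR_matrix_vector_assoc[symmetric])
    have \<alpha>w: "\<alpha> *v w \<noteq> 0"
      using form[of h1] e(3)[OF q] by (auto simp: u_def app)
    obtain x where x: "x \<noteq> 0" "\<alpha> *v x = 0" using singular_matrix_kernel[OF \<alpha>(2)] by blast
    obtain a b where ab: "x = a *\<^sub>R v + b *\<^sub>R w" using vw by blast
    have "a \<noteq> 0"
      using x \<alpha>w ab by (auto simp: matrix_vector_mult_scaleR)
    define m where "m = - b / a"
    have "a *\<^sub>R (\<alpha> *v v) = (- b) *\<^sub>R (\<alpha> *v w)"
      using x(2) ab by (simp add: matrix_vector_right_distrib matrix_vector_mult_scaleR eq_neg_iff_add_eq_0)
    then have "(1 / a) *\<^sub>R (a *\<^sub>R (\<alpha> *v v)) = (1 / a) *\<^sub>R ((- b) *\<^sub>R (\<alpha> *v w))" by (rule arg_cong)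
    then have \<alpha>v: "\<alpha> *v v = m *\<^sub>R (\<alpha> *v w)"
      using \<open>a \<noteq> 0\<close> by (simp add: m_def)
    have m: "fst (D q h) *v v = m *\<^sub>R (fst (D q h) *v w) \<and> snd (D q h) *v v = m *\<^sub>R (snd (D q h) *v w)" for h
      using form[of h] by (auto simp: app \<alpha>v matrix_vector_mult_scaleR)
    have "k q = m" using m[of h1] e(3)[OF q] by (simp add: k_def u_def)
    moreover have "(1 *\<^sub>R (fst (g q) ** \<alpha>), 0 *\<^sub>R (snd (g q) ** \<alpha>)) \<in> range (D q)"
      "(0 *\<^sub>R (fst (g q) ** \<alpha>), 1 *\<^sub>R (snd (g q) ** \<alpha>)) \<in> range (D q)"
      unfolding \<alpha>(3) by blast+
    then obtain a b where "D q a = (fst (g q) ** \<alpha>, 0)" "D q b = (0, snd (g q) ** \<alpha>)"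
      by (auto simp: image_iff)
    then have "fst (D q a) *v w \<noteq> 0 \<and> snd (D q a) = 0" "fst (D q b) = 0 \<and> snd (D q b) *v w \<noteq> 0"
      using \<alpha>w AB by (simp_all add: matrix_vector_mul_assoc[symmetric] SL2_mult_vec_eq_0)
    ultimately show ?thesis using m by blast
  qed
  have kconst: "(k has_derivative (\<lambda>h. 0)) (at q)" if q: "q \<in> ball q0 e" for q
  proof -
    have "q \<in> S" using q e by blast
    have "k differentiable (at q)"
      unfolding k_def using e(3)[OF q] diff[OF \<open>q \<in> S\<close>]
      by (intro differentiable_divide differentiable_inner) (auto simp: u_def)
    then obtain k' where k': "(k has_derivative k') (at q)" by (auto simp: differentiable_def)
    have C2': "Ck_on 2 (ball q0 e) g"
      using C2 e(2) by (rule Ck_on_subset)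
    have s1: "k' h *\<^sub>R (fst (D q h') *v w) = k' h' *\<^sub>R (fst (D q h) *v w)" for h h'
      unfolding D_def by (rule slope_differential[OF _ q C2' blf blf k']) (use slope in \<open>auto simp: D_def\<close>)
    have s2: "k' h *\<^sub>R (snd (D q h') *v w) = k' h' *\<^sub>R (snd (D q h) *v w)" for h h'
      unfolding D_def by (rule slope_differential[OF _ q C2' bls bls k']) (use slope in \<open>auto simp: D_def\<close>)
    obtain a b where a: "fst (D q a) *v w \<noteq> 0" "snd (D q a) = 0"
      and b: "fst (D q b) = 0" "snd (D q b) *v w \<noteq> 0"
      using slope[OF q] by blast
    \<comment> \<open>the direction \<open>a\<close> is invisible to the second component, \<open>b\<close> to the first\<close>
    have "k' a = 0" using s2[of a b] a b by simp
    then have "k' h = 0" for h using s1[of h a] a by simp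
    then have "k' = (\<lambda>h. 0)" by blast
    then show ?thesis using k' by simp
  qed
  have q0: "q0 \<in> ball q0 e" using e by simp
  have k: "k q = 0" if "q \<in> ball q0 e" for q
    using has_derivative_zero_unique_connected[OF open_ball connected_ball kconst that q0] k0 by simp
  have zero: "fst (D q h) *v v = 0" "snd (D q h) *v v = 0" if "q \<in> ball q0 e" for q h
    using slope[OF that] k[OF that] by simp_all
  have "((\<lambda>q. fst (g q) *v v) has_derivative (\<lambda>h. 0)) (at q)"
    "((\<lambda>q. snd (g q) *v v) has_derivative (\<lambda>h. 0)) (at q)" if q: "q \<in> ball q0 e" for q
    using bounded_linear.has_derivative[OF blf[of v] D[of q]]
      bounded_linear.has_derivative[OF bls[of v] D[of q]] zero[OF q] e(2) q by auto
  then have "fst (g q) *v v = fst (g q0) *v v" "snd (g q) *v v = snd (g q0) *v v" if "q \<in> ball q0 e" for q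
    using has_derivative_zero_unique_connected[OF open_ball connected_ball _ that q0] by blast+
  then show ?thesis using v(1) e by blast
qed

section \<open>Local congruence\<close>

abbreviation (input) unipotent :: "real \<Rightarrow> mat2" where
  "unipotent s \<equiv> vector [vector [1, s], vector [0, 1]]"

lemma unipotentI:
  assumes "X \<in> SL2" "X *v axis 1 1 = axis 1 1"
  shows "X = unipotent (X$1$2)"
proof -
  have "X$1$1 = 1" "X$2$1 = 0"
    using assms(2) by (auto simp: vec_eq_iff forall_2 matrix_vector_mult_def sum_2 axis_def)
  then show ?thesis using assms(1) by (simp add: vec_eq_iff forall_2 SL2_def det_2)
qed

text \<open>
  Translating on the right by \<open>C\<close> with first column along the constant kernel line, and on the left so that
  the point over \<open>q0\<close> becomes the identity, turns both components into matrices of determinant 1 fixing the first basis vector,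
  that is, into unipotent upper triangular ones. Their two free entries form a map \<open>\<sigma>\<close> between
  planes with injective differential, which is therefore open, so that its image can serve as the
  parameter domain \<open>V\<close>.
\<close>

lemma local_congruence:
  fixes g :: "real \<times> real \<Rightarrow> mat2 \<times> mat2"
  assumes S: "open S" "q0 \<in> S" and C2: "Ck_on 2 S g"
    and SL: "\<And>q. q \<in> S \<Longrightarrow> g q \<in> SL2xSL2"
    and inj: "\<And>q. q \<in> S \<Longrightarrow> inj (frechet_derivative g (at q))"
    and plane: "\<And>q. q \<in> S \<Longrightarrow> \<exists>\<alpha>. \<alpha> \<noteq> 0 \<and> det \<alpha> = 0 \<and>
      range (frechet_derivative g (at q)) =
        {(a *\<^sub>R (fst (g q) ** \<alpha>), b *\<^sub>R (snd (g q) ** \<alpha>)) | a b. True}"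
  shows "\<exists>\<phi> e V. nk_isometry \<phi> \<and> e > 0 \<and> ball q0 e \<subseteq> S \<and> open V \<and>
    \<phi> ` g ` ball q0 e = (\<lambda>(s, t). (unipotent (2 * s), unipotent (2 * t))) ` V"
proof -
  obtain v e where v: "v \<noteq> 0" and e: "e > 0" "ball q0 e \<subseteq> S"
    and const: "\<And>q. q \<in> ball q0 e \<Longrightarrow> fst (g q) *v v = fst (g q0) *v v"
      "\<And>q. q \<in> ball q0 e \<Longrightarrow> snd (g q) *v v = snd (g q0) *v v"
    using common_kernel_constant[OF S C2 SL plane] by blast
  obtain C r where C: "C \<in> SL2" "r \<noteq> 0" "C *v axis 1 1 = r *\<^sub>R v"
    using SL2_first_column[OF v] by blast
  obtain A0 B0 where g0: "g q0 = (A0, B0)" by fastforce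
  then have A0: "A0 \<in> SL2" and B0: "B0 \<in> SL2" using SL[OF S(2)] by (auto simp: SL2xSL2_def)
  define a b where "a = matrix_inv (A0 ** C)" and "b = matrix_inv (B0 ** C)"
  have ab: "a \<in> SL2" "b \<in> SL2" "a ** (A0 ** C) = mat 1" "b ** (B0 ** C) = mat 1"
    using A0 B0 C by (auto simp: a_def b_def SL2_inverse SL2_mult)
  define \<phi> :: "mat2 \<times> mat2 \<Rightarrow> mat2 \<times> mat2" where "\<phi> = (\<lambda>(X, Y). (a ** X ** C, b ** Y ** C))"
  define L :: "mat2 \<times> mat2 \<Rightarrow> real \<times> real" where "L = (\<lambda>Z. (fst Z $ 1 $ 2 / 2, snd Z $ 1 $ 2 / 2))"
  define F :: "real \<times> real \<Rightarrow> mat2 \<times> mat2" where "F = (\<lambda>(s, t). (unipotent (2 * s), unipotent (2 * t)))"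
  \<comment> \<open>the linear part of the affine map \<open>F\<close>\<close>
  define F' :: "real \<times> real \<Rightarrow> mat2 \<times> mat2" where
    "F' = (\<lambda>(s, t). (vector [vector [0, 2 * s], vector [0, 0]], vector [vector [0, 2 * t], vector [0, 0]]))"
  define \<sigma> where "\<sigma> = (\<lambda>q. L (\<phi> (g q)))"
  have iso: "nk_isometry \<phi>" unfolding \<phi>_def by (rule nk_isometry_translation[OF ab(1,2) C(1)])
  have bl\<phi>: "bounded_linear \<phi>" unfolding \<phi>_def
    by (auto intro!: linearI simp: linear_conv_bounded_linear[symmetric] matrix_mul_bilinear)
  have blL: "bounded_linear L" unfolding L_def
    by (auto intro!: linearI simp: linear_conv_bounded_linear[symmetric] add_divide_distrib)
  have blF: "bounded_linear F'" unfolding F'_def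
    by (auto intro!: linearI simp: linear_conv_bounded_linear[symmetric] vec_eq_iff forall_2)
  have Feq: "F p = F' p + (mat 1, mat 1)" for p
    by (cases p) (simp add: F_def F'_def vec_eq_iff forall_2 mat_def)
  have fix1: "\<phi> (g q) = F (\<sigma> q)" if q: "q \<in> ball q0 e" for q
  proof -
    obtain X Y where g: "g q = (X, Y)" by fastforce
    have XY: "X \<in> SL2" "Y \<in> SL2" using SL[of q] q e(2) g by (auto simp: SL2xSL2_def)
    have fixed: "(a ** X ** C) *v axis 1 1 = axis 1 1" if "X *v v = A0 *v v" "a ** (A0 ** C) = mat 1" for a X A0
    proof -
      have "(a ** X ** C) *v axis 1 1 = a *v (X *v (C *v axis 1 1))"
        by (simp add: matrix_vector_mul_assoc matrix_mul_assoc)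
      also have "\<dots> = a *v (A0 *v (C *v axis 1 1))"
        unfolding C(3) using that(1) by (simp add: matrix_vector_mult_scaleR)
      also have "\<dots> = axis 1 1"
        using that(2) by (simp add: matrix_vector_mul_assoc)
      finally show ?thesis .
    qed
    have "a ** X ** C = unipotent ((a ** X ** C)$1$2)"
      by (intro unipotentI fixed[of X A0] SL2_mult ab XY C) (use const(1)[OF q] g g0 in auto)
    moreover have "b ** Y ** C = unipotent ((b ** Y ** C)$1$2)"
      by (intro unipotentI fixed[of Y B0] SL2_mult ab XY C) (use const(2)[OF q] g g0 in auto)
    ultimately show ?thesis by (simp add: \<sigma>_def L_def F_def \<phi>_def g)
  qed
  have D: "(g has_derivative frechet_derivative g (at q)) (at q)" if "q \<in> S" for q
    using C2 that by (auto simp: numeral_2_eq_2 frechet_derivative_works[symmetric])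
  have \<sigma>': "(\<sigma> has_derivative (\<lambda>h. L (\<phi> (frechet_derivative g (at q) h)))) (at q)" if "q \<in> S" for q
    unfolding \<sigma>_def
    by (rule bounded_linear.has_derivative[OF blL bounded_linear.has_derivative[OF bl\<phi> D[OF that]]])
  have opn: "\<sigma> q \<in> interior (\<sigma> ` ball q0 e)" if q: "q \<in> ball q0 e" for q
  proof -
    let ?D = "frechet_derivative g (at q)"
    let ?\<sigma>' = "\<lambda>h. L (\<phi> (?D h))"
    have qS: "q \<in> S" using q e by blast
    have 1: "((\<lambda>q. \<phi> (g q)) has_derivative (\<lambda>h. \<phi> (?D h))) (at q)"
      by (rule bounded_linear.has_derivative[OF bl\<phi> D[OF qS]])
    have "((\<lambda>q. F' (\<sigma> q) + (mat 1, mat 1)) has_derivative (\<lambda>h. F' (?\<sigma>' h))) (at q)"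
      using has_derivative_add[OF bounded_linear.has_derivative[OF blF \<sigma>'[OF qS]] has_derivative_const] by simp
    then have 2: "((\<lambda>q. \<phi> (g q)) has_derivative (\<lambda>h. F' (?\<sigma>' h))) (at q)"
      by (rule has_derivative_transform_within_open[OF _ open_ball q]) (simp add: fix1 Feq)
    have eq: "\<phi> (?D h) = F' (?\<sigma>' h)" for h
      using fun_cong[OF has_derivative_unique[OF 1 2], of h] .
    have lin: "linear ?\<sigma>'" using \<sigma>'[OF qS] by (rule has_derivative_linear)
    have lD: "linear ?D" using D[OF qS] by (rule has_derivative_linear)
    have "h = 0" if "?\<sigma>' h = 0" for h
    proof -
      have "\<phi> (?D h) = F' 0" using eq[of h] unfolding that .
      then have "\<phi> (?D h) = 0" using linear_0[OF bounded_linear.linear[OF blF]] by simp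
      moreover have "\<phi> 0 = 0" using linear_0[OF bounded_linear.linear[OF bl\<phi>]] .
      moreover have "X = 0" if "a ** X ** C = 0" "a \<in> SL2" for a X :: mat2
      proof -
        have "a ** (X ** C) = 0" using that by (simp add: matrix_mul_assoc)
        then have "X ** C = 0" using that(2) SL2_mult_eq_0 by blast
        then have "X ** C ** matrix_inv C = 0" by simp
        then show ?thesis using C by (simp add: matrix_mul_assoc[symmetric] SL2_inverse)
      qed
      ultimately have "?D h = 0" using ab by (cases "?D h") (auto simp: \<phi>_def zero_prod_def)
      then show "h = 0" using inj[OF qS] linear_injective_0[OF lD] by blast
    qed
    then have "inj ?\<sigma>'" using linear_injective_0[OF lin] by blast
    then have "surj ?\<sigma>'" using lin by (rule linear_inj_imp_surj[rotated])
    then obtain k where k: "linear k" "?\<sigma>' \<circ> k = id"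
      using linear_surjective_right_inverse[OF lin] by blast
    show ?thesis
    proof (rule sussmann_open_mapping[OF open_ball _ q \<sigma>'[OF qS] _ k(2)])
      show "continuous_on (ball q0 e) \<sigma>"
        using has_derivative_continuous[OF \<sigma>'] e(2)
        by (auto intro!: continuous_at_imp_continuous_on)
    qed (use k q in \<open>auto simp: linear_conv_bounded_linear\<close>)
  qed
  have "interior (\<sigma> ` ball q0 e) = \<sigma> ` ball q0 e"
    using opn interior_subset by blast
  then have "open (\<sigma> ` ball q0 e)" using interior_eq by blast
  moreover have "\<phi> ` g ` ball q0 e = F ` \<sigma> ` ball q0 e"
    using fix1 by (simp add: image_image)
  ultimately show ?thesis using iso e F_def by blast
qed

section \<open>Passing to charts\<close>

lemma smooth_surface_chart:
  assumes "smooth_surface M \<A>" "(U, x) \<in> \<A>"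
  shows "openin M U" "open (x ` U)" "inj_on x U" "m \<in> U \<Longrightarrow> inv_into U x (x m) = m"
    "open T \<Longrightarrow> openin M {m \<in> U. x m \<in> T}"
proof -
  have h: "openin M U" "open (x ` U)" "homeomorphic_map (subtopology M U) (top_of_set (x ` U)) x"
    using assms by (auto simp: smooth_surface_def)
  then show "openin M U" "open (x ` U)" by auto
  have U: "topspace (subtopology M U) = U" using openin_subset[OF h(1)] by auto
  show i: "inj_on x U" using homeomorphic_imp_injective_map[OF h(3)] U by simp
  show "m \<in> U \<Longrightarrow> inv_into U x (x m) = m" using i by simp
  assume "open T"
  then have "openin (top_of_set (x ` U)) (x ` U \<inter> T)" by auto
  then have "openin (subtopology M U) {m \<in> U. x m \<in> x ` U \<inter> T}"
    using homeomorphic_imp_continuous_map[OF h(3)] U unfolding continuous_map_def by metis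
  then have "openin M {m \<in> U. x m \<in> x ` U \<inter> T}" using openin_trans_full h(1) by blast
  then show "openin M {m \<in> U. x m \<in> T}" by (rule back_subst[of "openin M"]) auto
qed

lemma smooth_onD:
  assumes "smooth_on S h" "q \<in> S"
  shows "(h has_derivative frechet_derivative h (at q)) (at q)"
proof -
  have "Ck_on (Suc 0) S h" using assms(1) by (simp add: smooth_on_def del: Ck_on.simps)
  then show ?thesis using assms(2) by (simp add: frechet_derivative_works[symmetric])
qed

text \<open>
  The chain rule for the change of coordinates. By symmetry in the two charts the ranges agree, so
  the union over charts in the definition of the tangent plane is the range for any single chart.
\<close>

lemma range_chart_subset:
  assumes "immersed_surface M \<A> f" "(U, x) \<in> \<A>" "(V, y) \<in> \<A>" "m \<in> U" "m \<in> V"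
  shows "range (frechet_derivative (f \<circ> inv_into V y) (at (y m)))
       \<subseteq> range (frechet_derivative (f \<circ> inv_into U x) (at (x m)))"
proof -
  let ?gx = "f \<circ> inv_into U x" and ?gy = "f \<circ> inv_into V y" and ?\<tau> = "x \<circ> inv_into V y"
  have M: "smooth_surface M \<A>" using assms(1) by (simp add: immersed_surface_def)
  note U = smooth_surface_chart[OF M assms(2)] and V = smooth_surface_chart[OF M assms(3)]
  have sm: "smooth_on (x ` U) ?gx" "smooth_on (y ` V) ?gy"
    using assms by (auto simp: immersed_surface_def)
  have \<tau>: "smooth_on (y ` (V \<inter> U)) ?\<tau>"
    using M assms(2,3) unfolding smooth_surface_def by blast
  have ym: "y m \<in> y ` (V \<inter> U)" using assms by blast
  have \<tau>m: "?\<tau> (y m) = x m" using V(4) assms by simp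
  have 1: "((\<lambda>q. ?gx (?\<tau> q)) has_derivative
     (\<lambda>h. frechet_derivative ?gx (at (x m)) (frechet_derivative ?\<tau> (at (y m)) h))) (at (y m))"
  proof (rule has_derivative_compose[OF smooth_onD[OF \<tau> ym]])
    show "(?gx has_derivative frechet_derivative ?gx (at (x m))) (at (?\<tau> (y m)))"
      unfolding \<tau>m using smooth_onD[OF sm(1)] assms(4) by blast
  qed
  have "(?gy has_derivative
     (\<lambda>h. frechet_derivative ?gx (at (x m)) (frechet_derivative ?\<tau> (at (y m)) h))) (at (y m))"
  proof (rule has_derivative_transform_within_open[OF 1 _ ym])
    show "open (y ` (V \<inter> U))" using \<tau> by (simp add: smooth_on_def)
    show "\<And>q. q \<in> y ` (V \<inter> U) \<Longrightarrow> ?gx (?\<tau> q) = ?gy q"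
      using U(4) V(4) by auto
  qed
  then have "frechet_derivative ?gy (at (y m)) =
     (\<lambda>h. frechet_derivative ?gx (at (x m)) (frechet_derivative ?\<tau> (at (y m)) h))"
    using frechet_derivative_at by metis
  then show ?thesis by auto
qed

lemma tangent_plane_chart:
  assumes "immersed_surface M \<A> f" "(U, x) \<in> \<A>" "m \<in> U"
  shows "tangent_plane \<A> f m = range (frechet_derivative (f \<circ> inv_into U x) (at (x m)))"
  unfolding tangent_plane_def using range_chart_subset[OF assms(1,2) _ assms(3)] assms(2,3) by blast

theorem theorem1:
  fixes M :: "'a topology"
    and \<A> :: "('a set \<times> ('a \<Rightarrow> real \<times> real)) set"
    and f :: "'a \<Rightarrow> mat2 \<times> mat2"
  assumes "immersed_surface M \<A> f"
    and "almost_complex_surface M \<A> f"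
    and "degenerate_surface M \<A> f"
    and "P_invariant_surface M \<A> f"
  shows "locally_congruent_to M f
    (\<lambda>(s, t). (vector [vector [1, 2 * s], vector [0, 1]],
               vector [vector [1, 2 * t], vector [0, 1]]))"
  unfolding locally_congruent_to_def
proof
  fix m0 assume "m0 \<in> topspace M"
  have M: "smooth_surface M \<A>" using assms(1) by (simp add: immersed_surface_def)
  obtain U x where Ux: "(U, x) \<in> \<A>" "m0 \<in> U"
    using M \<open>m0 \<in> topspace M\<close> unfolding smooth_surface_def by blast
  note U = smooth_surface_chart[OF M Ux(1)]
  let ?g = "f \<circ> inv_into U x"
  have sm: "smooth_on (x ` U) ?g" and inj: "\<And>q. q \<in> x ` U \<Longrightarrow> inj (frechet_derivative ?g (at q))"
    using assms(1) Ux by (auto simp: immersed_surface_def)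
  have top: "m \<in> topspace M" if "m \<in> U" for m using that openin_subset[OF U(1)] by blast
  have SL: "?g q \<in> SL2xSL2" if "q \<in> x ` U" for q
    using that top U(4) assms(1) by (auto simp: immersed_surface_def)
  have plane: "\<exists>\<alpha>. \<alpha> \<noteq> 0 \<and> det \<alpha> = 0 \<and> range (frechet_derivative ?g (at q)) =
        {(a *\<^sub>R (fst (?g q) ** \<alpha>), b *\<^sub>R (snd (?g q) ** \<alpha>)) | a b. True}" if q: "q \<in> x ` U" for q
  proof -
    obtain m where m: "m \<in> U" "q = x m" using q by blast
    have gq: "?g q = f m" using m U(4) by simp
    have T: "tangent_plane \<A> f m = range (frechet_derivative ?g (at q))"
      using tangent_plane_chart[OF assms(1) Ux(1) m(1)] m(2) by simp
    show ?thesis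
    proof (rule null_tangent_plane)
      show "(fst (?g q), snd (?g q)) \<in> SL2xSL2" using SL[OF q] by simp
      show "linear (frechet_derivative ?g (at q))"
        using smooth_onD[OF sm q] by (rule has_derivative_linear)
      show "inj (frechet_derivative ?g (at q))" by (rule inj[OF q])
    qed (use assms(2-4) top[OF m(1)] in
      \<open>auto simp: almost_complex_surface_def degenerate_surface_def P_invariant_surface_def T[symmetric] gq simp del: o_apply\<close>)
  qed
  have C2: "Ck_on 2 (x ` U) ?g" using sm unfolding smooth_on_def by blast
  obtain \<phi> e V where c: "nk_isometry \<phi>" "e > 0" "ball (x m0) e \<subseteq> x ` U" "open V"
    "\<phi> ` ?g ` ball (x m0) e = (\<lambda>(s, t). (unipotent (2 * s), unipotent (2 * t))) ` V"
    using local_congruence[OF U(2) _ C2 SL inj plane, of "x m0"] Ux(2) by blast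
  let ?N = "{m \<in> U. x m \<in> ball (x m0) e}"
  have "f ` ?N = ?g ` ball (x m0) e"
  proof -
    have "f ` ?N = ?g ` x ` ?N" using U(4) by (auto simp: image_image)
    also have "x ` ?N = ball (x m0) e" using c(3) by auto
    finally show ?thesis .
  qed
  moreover have "openin M ?N" "m0 \<in> ?N" using U(5)[OF open_ball] Ux c by auto
  ultimately show "\<exists>U \<phi> V. openin M U \<and> m0 \<in> U \<and> nk_isometry \<phi> \<and> open V \<and>
        \<phi> ` f ` U = (\<lambda>(s, t). (vector [vector [1, 2 * s], vector [0, 1]],
               vector [vector [1, 2 * t], vector [0, 1]])) ` V"
    using c(1,4,5) by (intro exI[of _ ?N] exI[of _ \<phi>] exI[of _ V]) simp
qed

end
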